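(* If $(K,v)$ is an extremal valued field of characteristic $p>0$ with $[K:K^p]<\infty$, then for every additive polynomial $f\in K[X_1,\dots,X_n]$ (any $n\ge1$), the image $f(K^n)$ has the optimal approximation property.
   Context: A valued field $(K,v)$ with valuation ring ${\cal O}$ is extremal if for every $n\ge1$ and every polynomial $g(X_1,\dots,X_n)$ over $K$ the set $\{v(g(a_1,\dots,a_n))\mid a_1,\dots,a_n\in{\cal O}\}$ has a maximal element. A polynomial $f\in K[X_1,\dots,X_n]$ is additive if $f(x+y)=f(x)+f(y)$ for all $x,y$ in $K^n$ (equivalently in every extension field). A subset $S\subseteq K$ has the optimal approximation property if for every $z\in K$ there is $y\in S$ with $v(z-y)=\max\{v(z-x)\mid x\in S\}$. *)

theory Defs
  imports
    "HOL-Library.Extended"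
    "HOL-Library.Poly_Mapping"
    "HOL-Algebra.Algebraic_Closure_Type"
begin

text \<open>
  Valuations are written additively, with values in an arbitrary linearly ordered abelian group
  extended by an infinite element (\<open>Pinf\<close>), so that \<open>v x = Pinf\<close> iff \<open>x = 0\<close>. The type
  \<open>extended\<close> also has a least element \<open>Minf\<close>, which a valuation must not attain. The value
  group is the set of values on nonzero elements; it may be a proper subgroup of \<open>'g\<close>.
\<close>

locale valued_field =
  fixes v :: "'a::field \<Rightarrow> 'g::linordered_ab_group_add extended"
  assumes not_Minf: "v x \<noteq> Minf"
    and eq_Pinf_iff: "v x = Pinf \<longleftrightarrow> x = 0"
    and mult: "v (x * y) = v x + v y"
    and add: "min (v x) (v y) \<le> v (x + y)"

definition valuation_ring :: "('a::field \<Rightarrow> 'g::linordered_ab_group_add extended) \<Rightarrow> 'a set" where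
  "valuation_ring v = {x. 0 \<le> v x}"

text \<open>
  A polynomial is a finitely supported map from monomials to coefficients, a monomial being a
  finitely supported map from variable indices to exponents. The variables of a polynomial in
  \<open>n\<close> variables are numbered \<open>0, \<dots>, n - 1\<close>. A point of the \<open>n\<close>-dimensional affine space is given
  by a function on all of \<open>nat\<close>, of which only the values below \<open>n\<close> matter.
\<close>

type_synonym 'a mpoly = "(nat \<Rightarrow>\<^sub>0 nat) \<Rightarrow>\<^sub>0 'a"

definition mpolys :: "nat \<Rightarrow> 'a::field mpoly set" where
  "mpolys n = {f. \<forall>m \<in> Poly_Mapping.keys f. Poly_Mapping.keys m \<subseteq> {..<n}}"

definition eval_mpoly :: "'a::field mpoly \<Rightarrow> (nat \<Rightarrow> 'a) \<Rightarrow> 'a" where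
  "eval_mpoly f a =
    (\<Sum>m \<in> Poly_Mapping.keys f. Poly_Mapping.lookup f m *
      (\<Prod>i \<in> Poly_Mapping.keys m. a i ^ Poly_Mapping.lookup m i))"

lemma eval_mpoly_cong:
  assumes "f \<in> mpolys n" and "\<And>i. i < n \<Longrightarrow> a i = b i"
  shows "eval_mpoly f a = eval_mpoly f b"
  unfolding eval_mpoly_def
proof (rule sum.cong[OF refl])
  fix m assume "m \<in> Poly_Mapping.keys f"
  with assms have "a i = b i" if "i \<in> Poly_Mapping.keys m" for i
    using that by (force simp: mpolys_def)
  then show "Poly_Mapping.lookup f m * (\<Prod>i \<in> Poly_Mapping.keys m. a i ^ Poly_Mapping.lookup m i)
    = Poly_Mapping.lookup f m * (\<Prod>i \<in> Poly_Mapping.keys m. b i ^ Poly_Mapping.lookup m i)"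
    by simp
qed

definition additive_mpoly :: "'a::field mpoly \<Rightarrow> bool" where
  "additive_mpoly f \<longleftrightarrow>
    (\<forall>x y. eval_mpoly f (\<lambda>i. x i + y i) = eval_mpoly f x + eval_mpoly f y)"

definition has_maximal_element :: "'b::linorder set \<Rightarrow> bool" where
  "has_maximal_element A \<longleftrightarrow> (\<exists>m \<in> A. \<forall>x \<in> A. x \<le> m)"

definition extremal :: "('a::field \<Rightarrow> 'g::linordered_ab_group_add extended) \<Rightarrow> bool" where
  "extremal v \<longleftrightarrow>
    (\<forall>n \<ge> 1. \<forall>g \<in> mpolys n.
      has_maximal_element {v (eval_mpoly g a) | a. \<forall>i < n. a i \<in> valuation_ring v})"

definition optimal_approximation ::
    "('a::field \<Rightarrow> 'g::linordered_ab_group_add extended) \<Rightarrow> 'a set \<Rightarrow> bool" where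
  "optimal_approximation v S \<longleftrightarrow> (\<forall>z. \<exists>y \<in> S. \<forall>x \<in> S. v (z - x) \<le> v (z - y))"

text \<open>
  \<open>finite_degree F\<close> says that the field given by the whole type \<open>'a\<close> has finite degree over its
  subfield \<open>F\<close>.
\<close>

definition finite_degree :: "'a::field set \<Rightarrow> bool" where
  "finite_degree F \<longleftrightarrow> ring.finite_dimension (ring_of_type_algebra :: 'a ring) F UNIV"

end

theory Submission
  imports Defs
begin

text \<open>
  If \<open>K\<close> is infinite, an additive polynomial is a sum \<open>g\<^sub>1(X\<^sub>1) + \<dots> + g\<^sub>n(X\<^sub>n)\<close> of \<open>p\<close>-polynomials in one
  variable. A linear relation \<open>\<Sum> a\<^sub>i \<alpha>\<^sub>i^(p^d\<^sub>i) = 0\<close> between the leading coefficients allows one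
  \<open>g\<^sub>i\<close> to be replaced by a \<open>p\<close>-polynomial of lower degree without changing the image; hence the
  leading coefficients can be made independent, and, writing each variable in a basis of \<open>K\<close> over
  \<open>K^(p^e)\<close>, all degrees can be made equal to some \<open>p^N\<close>. For the leading form
  \<open>\<phi>(x) = \<Sum> a\<^sub>j x\<^sub>j^(p^N)\<close>, extremality applied to \<open>\<phi>\<close> with one variable set to \<open>1\<close> gives a nonzero
  maximum, and by homogeneity \<open>v(\<phi>(x)) \<le> C + p^N min v(x\<^sub>j)\<close>. The other terms are negligible when
  \<open>min v(x\<^sub>j)\<close> is very negative, so that outside some box \<open>c O\<^sup>m\<close> the image approximates
  \<open>z\<close> no better than \<open>0\<close> does, and extremality on this box gives the optimal approximation. If \<open>K\<close> is finite, there
  are only finitely many values.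
\<close>

section \<open>\<open>p\<close>-polynomials\<close>

text \<open>
  Only the exponents \<open>p^i\<close> with \<open>i < n\<close> occur, so the leading term \<open>x^(p^n)\<close> first appears at \<open>Suc n\<close>.
\<close>

primrec ppolys :: "nat \<Rightarrow> nat \<Rightarrow> ('a::field \<Rightarrow> 'a) set" where
  "ppolys p 0 = {\<lambda>_. 0}"
| "ppolys p (Suc n) = {\<lambda>x. g x + a * x ^ (p ^ n) | g a. g \<in> ppolys p n}"

lemma ppolys_zero: "(\<lambda>_. 0) \<in> ppolys p n"
proof (induction n)
  case (Suc n)
  then show ?case
    by (auto intro!: exI[of _ "\<lambda>_. 0"] exI[of _ 0])
qed simp

lemma ppolys_mono:
  assumes "n \<le> m"
  shows "ppolys p n \<subseteq> ppolys p m"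
proof (rule lift_Suc_mono_le[OF _ assms])
  show "ppolys p n \<subseteq> ppolys p (Suc n)" for n
    by (auto intro!: exI[of _ 0])
qed

lemma ppolys_add:
  "g \<in> ppolys p n \<Longrightarrow> h \<in> ppolys p n \<Longrightarrow> (\<lambda>x. g x + h x) \<in> ppolys p n"
proof (induction n arbitrary: g h)
  case (Suc n)
  then obtain g' h' a b where *: "g = (\<lambda>x. g' x + a * x ^ (p ^ n))" "g' \<in> ppolys p n"
    "h = (\<lambda>x. h' x + b * x ^ (p ^ n))" "h' \<in> ppolys p n"
    by auto
  then have "(\<lambda>x. g x + h x) = (\<lambda>x. (g' x + h' x) + (a + b) * x ^ (p ^ n))"
    by (simp add: algebra_simps)
  with Suc.IH[OF *(2,4)] show ?case by auto
qed auto

lemma ppolys_sum: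
  "(\<And>i. i \<in> I \<Longrightarrow> g i \<in> ppolys p n) \<Longrightarrow> (\<lambda>x. \<Sum>i\<in>I. g i x) \<in> ppolys p n"
  by (induction I rule: infinite_finite_induct) (simp_all add: ppolys_zero ppolys_add)

text \<open>Every exponent is multiplied by \<open>p ^ e\<close>, which shifts the bound by
  \<open>e\<close>. Both the cancellation of leading terms and the passage to a common degree are
  substitutions of this kind.\<close>

lemma ppolys_comp:
  "g \<in> ppolys p n \<Longrightarrow> (\<lambda>x. g (b * x ^ (p ^ e))) \<in> ppolys p (n + e)"
proof (induction n arbitrary: g)
  case 0
  then show ?case by (simp add: ppolys_zero)
next
  case (Suc n)
  then obtain g' a where *: "g = (\<lambda>x. g' x + a * x ^ (p ^ n))" "g' \<in> ppolys p n"
    by auto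
  then have "(\<lambda>x. g (b * x ^ (p ^ e))) =
      (\<lambda>x. g' (b * x ^ (p ^ e)) + (a * b ^ (p ^ n)) * x ^ (p ^ (n + e)))"
    by (simp add: power_mult_distrib power_add mult_ac flip: power_mult)
  with Suc.IH[OF *(2)] show ?case by auto
qed

text \<open>
  \<open>S\<close> is the image of \<open>\<Sum>j\<in>J. g\<^sub>j(x\<^sub>j)\<close>, where \<open>g\<^sub>j\<close> has degree \<open>p^(d j)\<close>, leading coefficient \<open>a j\<close>
  and remaining terms \<open>l j\<close>. Independence of the \<open>a j\<close> includes that they are nonzero.
\<close>

definition reduced_form ::
    "nat \<Rightarrow> 'i set \<Rightarrow> ('i \<Rightarrow> nat) \<Rightarrow> ('i \<Rightarrow> 'a::field \<Rightarrow> 'a) \<Rightarrow> ('i \<Rightarrow> 'a) \<Rightarrow> 'a set \<Rightarrow> bool" where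
  "reduced_form p J d l a S \<longleftrightarrow> finite J \<and> (\<forall>j\<in>J. l j \<in> ppolys p (d j)) \<and>
    (\<forall>\<alpha>. (\<Sum>j\<in>J. a j * \<alpha> j ^ (p ^ d j)) = 0 \<longrightarrow> (\<forall>j\<in>J. \<alpha> j = 0)) \<and>
    S = range (\<lambda>x. \<Sum>j\<in>J. l j (x j) + a j * x j ^ (p ^ d j))"

context
  fixes p :: nat
  assumes char: "CHAR('a::field) = p" and p_pos: "p > 0"
begin

lemma prime_p: "prime p"
  using prime_CHAR_semidom[where ?'a = 'a] char p_pos by simp

lemma frob_add: "(x + y :: 'a) ^ (p ^ n) = x ^ (p ^ n) + y ^ (p ^ n)"
  using freshmans_dream'[of "p ^ n" n x y] prime_p char by simp

lemma frob_sum: "(\<Sum>i\<in>I. f i :: 'a) ^ (p ^ n) = (\<Sum>i\<in>I. f i ^ (p ^ n))"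
  using p_pos by (induction I rule: infinite_finite_induct) (simp_all add: frob_add)

section \<open>Finite bases of the field over its \<open>p^n\<close>-th powers\<close>

text \<open>\<open>K\<close> as a vector space over \<open>K^(p^n)\<close>, with the scalar field identified with \<open>K\<close> via Frobenius.\<close>

interpretation frob: vector_space "\<lambda>c x :: 'a. c ^ (p ^ n) * x" for n :: nat
  by unfold_locales (simp_all add: frob_add algebra_simps power_mult_distrib)

text \<open>A tower argument: if \<open>B\<close> spans over the \<open>p^n\<close>-th powers and
  \<open>A\<close> over the \<open>p\<close>-th powers, then the products
  \<open>b * a ^ (p ^ n)\<close> span over the \<open>p^(n+1)\<close>-th powers, because raising an
  expansion in \<open>A\<close> to the power \<open>p ^ n\<close> acts termwise.\<close>

lemma finite_spanning_set_frob:
  assumes "finite_degree (range (\<lambda>x::'a. x ^ p))"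
  shows "\<exists>B. finite B \<and> frob.span n B = UNIV"
proof (induction n)
  case 0
  have "x \<in> frob.span 0 {1}" for x
    using frob.span_scale[OF frob.span_base[of 1 "{1}" 0], of x] by simp
  then show ?case by blast
next
  case (Suc n)
  interpret K: ring "ring_of_type_algebra :: 'a ring"
    by (rule ring_from_type_algebra)
  \<comment> \<open>\<open>K.dimension\<close> builds a subspace by adjoining one vector
    \<open>u\<close> at a time; each such \<open>u\<close> joins the spanning set.\<close>
  have *: "\<exists>B. finite B \<and> E \<subseteq> frob.span 1 B"
    if "K.dimension m (range (\<lambda>x::'a. x ^ p)) E" for m E
    using that
  proof (induction m "range (\<lambda>x::'a. x ^ p)" E rule: K.dimension.induct)
    case zero_dim
    have "{\<zero>\<^bsub>ring_of_type_algebra\<^esub>} \<subseteq> frob.span 1 ({} :: 'a set)"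
      using frob.span_zero[of 1 "{}"] by (simp add: ring_of_type_algebra_def)
    then show ?case by blast
  next
    case (Suc_dim u E m)
    then obtain B where B: "finite B" "E \<subseteq> frob.span 1 B" by blast
    have "K.line_extension (range (\<lambda>x. x ^ p)) u E \<subseteq> frob.span 1 (insert u B)"
    proof
      fix x assume "x \<in> K.line_extension (range (\<lambda>x. x ^ p)) u E"
      then obtain c e where x: "x = c ^ p * u + e" "e \<in> E"
        unfolding K.line_extension_def r_coset_def set_add_def'
        by (auto simp: ring_of_type_algebra_def)
      have "e \<in> frob.span 1 (insert u B)"
        using x B frob.span_mono[of B "insert u B" 1] by blast
      have "c ^ p * u \<in> frob.span 1 (insert u B)"
        using frob.span_scale[OF frob.span_base[of u "insert u B" 1], of c] by simp
      from frob.span_add[OF this \<open>e \<in> frob.span 1 (insert u B)\<close>]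
      show "x \<in> frob.span 1 (insert u B)"
        by (simp only: x)
    qed
    with B(1) show ?case
      by (intro exI[of _ "insert u B"]) simp
  qed
  obtain A where A: "finite A" "frob.span 1 A = UNIV"
    using assms unfolding finite_degree_def K.finite_dimension_def
    by (metis * top.extremum_unique)
  obtain B where B: "finite B" "frob.span n B = UNIV"
    using Suc by blast
  define C where "C = (\<lambda>(b, a). b * a ^ (p ^ n)) ` (B \<times> A)"
  have mult: "b * y ^ (p ^ n) \<in> frob.span (Suc n) C" if "b \<in> B" for b y
  proof -
    have "y \<in> frob.span 1 A" using A by simp
    then show ?thesis
    proof (induction rule: frob.span_induct_alt)
      case base
      have "b * 0 ^ (p ^ n) = 0" using p_pos by simp
      then show ?case by (simp only: frob.span_zero)
    next
      case (step c a y)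
      have "b * a ^ (p ^ n) \<in> C" using step \<open>b \<in> B\<close> by (auto simp: C_def)
      then have "c ^ p ^ Suc n * (b * a ^ (p ^ n)) \<in> frob.span (Suc n) C"
        by (intro frob.span_scale frob.span_base)
      from frob.span_add[OF this step(2)]
      have "c ^ p ^ Suc n * (b * a ^ (p ^ n)) + b * y ^ (p ^ n) \<in> frob.span (Suc n) C" .
      also have "c ^ p ^ Suc n * (b * a ^ (p ^ n)) + b * y ^ (p ^ n) = b * (c ^ p ^ 1 * a + y) ^ (p ^ n)"
        by (simp add: frob_add algebra_simps power_mult_distrib flip: power_mult)
      finally show ?case .
    qed
  qed
  have "x \<in> frob.span (Suc n) C" for x
  proof -
    have "x \<in> frob.span n B" using B by simp
    then show ?thesis
    proof (induction rule: frob.span_induct_alt)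
      case base
      show ?case by (rule frob.span_zero)
    next
      case (step c b y)
      from frob.span_add[OF mult[OF step(1), of c] step(2)] show ?case
        by (simp add: mult.commute)
    qed
  qed
  moreover have "finite C" using A B by (simp add: C_def)
  ultimately show ?case by blast
qed

text \<open>Coordinates are exposed as \<open>y b\<close> rather than as the scalars
  \<open>y b ^ (p ^ n)\<close>, since the \<open>y b\<close> will serve as new variables.\<close>

lemma finite_basis_frob:
  assumes "finite_degree (range (\<lambda>x::'a. x ^ p))"
  shows "\<exists>B. finite B \<and> (\<forall>x::'a. \<exists>y. x = (\<Sum>b\<in>B. b * y b ^ (p ^ n))) \<and>
    (\<forall>y. (\<Sum>b\<in>B. b * y b ^ (p ^ n)) = 0 \<longrightarrow> (\<forall>b\<in>B. y b = 0))"
proof -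
  obtain A where A: "finite A" "frob.span n A = UNIV"
    using finite_spanning_set_frob[OF assms] by blast
  obtain B where B: "B \<subseteq> A" "frob.independent n B" "A \<subseteq> frob.span n B"
    by (rule frob.maximal_independent_subset)
  have "frob.span n A \<subseteq> frob.span n B"
    using B(3) by (simp add: frob.span_minimal)
  then have sp: "frob.span n B = UNIV" using A by blast
  have fin: "finite B" using A B finite_subset by blast
  show ?thesis
  proof (intro exI[of _ B] conjI allI impI ballI)
    show "finite B" by fact
    show "\<exists>y. x = (\<Sum>b\<in>B. b * y b ^ (p ^ n))" for x
      using sp unfolding frob.span_finite[OF fin] by (auto simp: mult.commute set_eq_iff)
    show "y b = 0" if "(\<Sum>b\<in>B. b * y b ^ (p ^ n)) = 0" "b \<in> B" for y b
      using frob.independentD[OF B(2) fin, of y b] that by (auto simp: mult.commute)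
  qed
qed

section \<open>Reduction of additive polynomials to independent leading coefficients\<close>

lemma ppolys_additive: "g \<in> ppolys p n \<Longrightarrow> g (x + y :: 'a) = g x + g y"
proof (induction n arbitrary: g)
  case (Suc n)
  then obtain g' a where *: "g = (\<lambda>x. g' x + a * x ^ (p ^ n))" "g' \<in> ppolys p n"
    by auto
  with Suc.IH[OF *(2)] show ?case by (simp add: frob_add algebra_simps)
qed simp

lemma ppolys_at_0: "g \<in> ppolys p n \<Longrightarrow> g (0 :: 'a) = 0"
  using ppolys_additive[of g n 0 0] by (metis add_0 add_cancel_right_right)

section \<open>One-variable additive polynomials\<close>

lemma inj_frob: "inj (\<lambda>x::'a. x ^ p)"
proof (rule injI)
  fix x y :: 'a assume "x ^ p = y ^ p"
  with frob_add[of "x - y" y 1] show "x = y" by simp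
qed

lemma poly_eqI_infinite:
  fixes q r :: "'a poly"
  assumes "infinite A" "\<And>x. x \<in> A \<Longrightarrow> poly q x = poly r x"
  shows "q = r"
proof (rule ccontr)
  assume "q \<noteq> r"
  then have "finite {x. poly (q - r) x = 0}"
    by (intro poly_roots_finite) simp
  moreover have "A \<subseteq> {x. poly (q - r) x = 0}"
    using assms(2) by auto
  ultimately show False
    using assms(1) finite_subset by blast
qed

text \<open>
  Additivity makes the derivative constant, so \<open>q = c X + r(X^p)\<close>. The polynomial \<open>r\<close> is then known
  to be additive on \<open>p\<close>-th powers only, which is why the set \<open>A\<close> is needed for the induction.
\<close>

lemma additive_poly_in_ppolys:
  fixes q :: "'a poly"
  assumes "infinite A" "\<And>x y. x \<in> A \<Longrightarrow> y \<in> A \<Longrightarrow> x + y \<in> A"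
    and "\<And>x y. x \<in> A \<Longrightarrow> y \<in> A \<Longrightarrow> poly q (x + y) = poly q x + poly q y"
  shows "\<exists>n. poly q \<in> ppolys p n"
  using assms
proof (induction "degree q" arbitrary: q A rule: less_induct)
  case less
  have p2: "p \<ge> 2" using prime_p by (rule prime_ge_2_nat)
  obtain y0 where y0: "y0 \<in> A" using less.prems(1) by fastforce
  \<comment> \<open>For fixed \<open>y\<close> in \<open>A\<close>, additivity holds at infinitely
    many values of the other argument, hence as an identity of polynomials.\<close>
  have shift: "pcompose q [:y, 1:] = q + [:poly q y:]" if "y \<in> A" for y
    using less.prems that by (intro poly_eqI_infinite[of A]) (auto simp: poly_pcompose add.commute)
  have q0: "coeff q 0 = 0"
    using arg_cong[OF shift[OF y0], of "\<lambda>q. poly q 0"] by (simp add: poly_pcompose poly_0_coeff_0)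
  \<comment> \<open>Differentiating \<open>shift\<close> shows that the derivative is invariant
    under translation by \<open>y\<close>; at 0 this says that it takes its value at 0 again at
    every \<open>y\<close> in \<open>A\<close>.\<close>
  have "pderiv q = [:poly (pderiv q) 0:]"
  proof (rule poly_eqI_infinite)
    fix y assume "y \<in> A"
    from arg_cong[OF shift[OF this], of pderiv]
    have "pcompose (pderiv q) [:y, 1:] = pderiv q"
      by (simp add: pderiv_pcompose pderiv_add pderiv_pCons)
    from arg_cong[OF this, of "\<lambda>q. poly q 0"]
    show "poly (pderiv q) y = poly [:poly (pderiv q) 0:] y"
      by (simp add: poly_pcompose)
  qed fact
  then have "coeff (pderiv q) (Suc j) = 0" for j
    by (metis coeff_pCons_Suc coeff_0)
  \<comment> \<open>For k \<ge> 2 the derivative has the coefficient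
    \<open>of_nat k * coeff q k\<close> in degree k - 1, which is zero, and \<open>of_nat k\<close>
    is nonzero unless \<open>p\<close> divides k.\<close>
  then have vanish: "coeff q k = 0" if "k \<noteq> 1" "\<not> p dvd k" for k
    using that q0 char
    by (cases k rule: nat.exhaust; cases "k - 1")
      (auto simp: coeff_pderiv simp del: of_nat_Suc simp: of_nat_eq_0_iff_char_dvd)
  define D where "D = degree q"
  show ?case
  proof (cases "D = 0")
    case True
    with q0 have "q = 0"
      unfolding D_def by (auto elim: degree_eq_zeroE)
    then show ?thesis by (intro exI[of _ 0]) (simp add: fun_eq_iff)
  next
    case False
    define r where "r = (\<Sum>i\<le>D. monom (coeff q (p * i)) i)"
    have coeff_r: "coeff r i = (if i \<le> D then coeff q (p * i) else 0)" for i
      unfolding r_def by (auto simp: coeff_sum)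
    have "degree r \<le> D - 1"
    proof (rule degree_le, intro allI impI)
      fix i assume "D - 1 < i"
      then have "D < 2 * i" using False by linarith
      also have "\<dots> \<le> p * i" using p2 by simp
      finally show "coeff r i = 0" by (simp add: coeff_r D_def coeff_eq_0)
    qed
    then have deg: "degree r < degree q" using False D_def by linarith
    have eq: "poly q x = coeff q 1 * x + poly r (x ^ p)" for x
    proof -
      have vanish': "coeff q j = 0" if "j \<notin> (*) p ` {..D}" "j \<le> p * D" "j \<noteq> Suc 0" for j
      proof (rule vanish)
        show "\<not> p dvd j"
        proof
          assume "p dvd j"
          then obtain i where "j = p * i" by (rule dvdE)
          with that p2 show False by auto
        qed
      qed (use that in simp)
      \<comment> \<open>The sum is first extended to \<open>p * D\<close> so that its range contains
        every exponent \<open>p * i\<close> with \<open>i \<le> D\<close>.\<close>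
      have "D \<le> p * D" using p2 by simp
      then have "poly q x = (\<Sum>j\<le>p * D. coeff q j * x ^ j)"
        unfolding poly_altdef D_def[symmetric]
        by (intro sum.mono_neutral_left) (auto simp: D_def coeff_eq_0)
      also have "\<dots> = (\<Sum>j\<in>insert 1 ((*) p ` {..D}). coeff q j * x ^ j)"
        using vanish' False p2 by (intro sum.mono_neutral_right) auto
      also have "\<dots> = coeff q 1 * x + (\<Sum>j\<in>(*) p ` {..D}. coeff q j * x ^ j)"
        using p2 by (subst sum.insert) auto
      also have "(\<Sum>j\<in>(*) p ` {..D}. coeff q j * x ^ j) = (\<Sum>i\<le>D. coeff q (p * i) * x ^ (p * i))"
        using p2 by (subst sum.reindex) (auto simp: inj_on_def)
      also have "\<dots> = poly r (x ^ p)"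
        by (simp add: r_def poly_sum poly_monom power_mult)
      finally show ?thesis .
    qed
    let ?A = "(\<lambda>x. x ^ p) ` A"
    have frob1: "(x + y :: 'a) ^ p = x ^ p + y ^ p" for x y
      using frob_add[of x y 1] by simp
    have "\<exists>n. poly r \<in> ppolys p n"
    proof (rule less.hyps[OF deg])
      show "infinite ?A"
        using less.prems(1) inj_frob by (meson finite_imageD inj_on_subset subset_UNIV)
      show "u + w \<in> ?A" if "u \<in> ?A" "w \<in> ?A" for u w
        using that less.prems(2) by (auto simp flip: frob1)
      show "poly r (u + w) = poly r u + poly r w" if uw: "u \<in> ?A" "w \<in> ?A" for u w
      proof -
        from uw obtain x y where "x \<in> A" "y \<in> A" "u = x ^ p" "w = y ^ p" by auto
        with less.prems(3)[of x y] show ?thesis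
          by (simp add: eq frob1 algebra_simps)
      qed
    qed
    then obtain n where "poly r \<in> ppolys p n" by blast
    from ppolys_comp[OF this, of 1 1] have 1: "(\<lambda>x. poly r (x ^ p)) \<in> ppolys p (Suc n)"
      by simp
    have "(\<lambda>x. coeff q 1 * x) \<in> ppolys p (Suc 0)"
      by auto
    then have 2: "(\<lambda>x. coeff q 1 * x) \<in> ppolys p (Suc n)"
      using ppolys_mono[of "Suc 0" "Suc n"] by blast
    have "poly q = (\<lambda>x. coeff q 1 * x + poly r (x ^ p))"
      using eq by blast
    with ppolys_add[OF 2 1] have "poly q \<in> ppolys p (Suc n)" by (simp only:)
    then show ?thesis by blast
  qed
qed

text \<open>A zero summand (\<open>m i = 0\<close>) is dropped, and a nontrivial relation between
  the leading coefficients lowers one \<open>m i\<close> by 1 without changing the image. The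
  \<open>Suc\<close> in the induction measure makes the first of these moves decrease it
  too.\<close>

lemma leading_coefficients_independent:
  fixes g :: "'i \<Rightarrow> 'a \<Rightarrow> 'a"
  assumes "finite I" "\<And>i. i \<in> I \<Longrightarrow> g i \<in> ppolys p (m i)"
  shows "\<exists>J d l a. reduced_form p (J :: 'i set) d l a (range (\<lambda>x. \<Sum>i\<in>I. g i (x i)))"
  using assms
proof (induction "\<Sum>i\<in>I. Suc (m i)" arbitrary: I g m rule: less_induct)
  case less
  show ?case
  proof (cases "\<exists>i\<in>I. m i = 0")
    case True
    then obtain i where i: "i \<in> I" "m i = 0" by blast
    then have "g i = (\<lambda>_. 0)" using less.prems(2)[OF i(1)] by simp
    then have "(\<Sum>i\<in>I. g i (x i)) = (\<Sum>i\<in>I - {i}. g i (x i))" for x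
      using i less.prems(1) by (simp add: sum.remove)
    moreover have "(\<Sum>i\<in>I - {i}. Suc (m i)) < (\<Sum>i\<in>I. Suc (m i))"
      using i less.prems(1) by (simp add: sum.remove)
    from less.hyps[OF this, of g] less.prems
    have "\<exists>J d l a. reduced_form p (J :: 'i set) d l a (range (\<lambda>x. \<Sum>i\<in>I - {i}. g i (x i)))"
      by simp
    ultimately show ?thesis by simp
  next
    case False
    define d where "d = (\<lambda>i. m i - 1)"
    have m: "m i = Suc (d i)" if "i \<in> I" for i
      using False that by (auto simp: d_def)
    have "\<exists>l a. l \<in> ppolys p (d i) \<and> g i = (\<lambda>x. l x + a * x ^ (p ^ d i))" if "i \<in> I" for i
      using less.prems(2)[OF that] m[OF that] by auto
    then obtain l a where l: "\<And>i. i \<in> I \<Longrightarrow> l i \<in> ppolys p (d i)"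
      and g: "\<And>i. i \<in> I \<Longrightarrow> g i = (\<lambda>x. l i x + a i * x ^ (p ^ d i))"
      by metis
    show ?thesis
    proof (cases "\<forall>\<alpha>. (\<Sum>j\<in>I. a j * \<alpha> j ^ (p ^ d j)) = 0 \<longrightarrow> (\<forall>j\<in>I. \<alpha> j = 0)")
      case True
      moreover have "(\<Sum>i\<in>I. g i (x i)) = (\<Sum>j\<in>I. l j (x j) + a j * x j ^ (p ^ d j))" for x
        by (intro sum.cong) (simp_all add: g)
      ultimately have "reduced_form p I d l a (range (\<lambda>x. \<Sum>i\<in>I. g i (x i)))"
        using l less.prems(1) by (simp add: reduced_form_def)
      then show ?thesis by blast
    next
      case False
      then obtain \<alpha> where \<alpha>: "(\<Sum>j\<in>I. a j * \<alpha> j ^ (p ^ d j)) = 0" "\<exists>j\<in>I. \<alpha> j \<noteq> 0"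
        by blast
      let ?I = "{j \<in> I. \<alpha> j \<noteq> 0}"
      have "finite (d ` ?I)" "d ` ?I \<noteq> {}" using \<alpha>(2) less.prems(1) by auto
      then have "Max (d ` ?I) \<in> d ` ?I" "\<And>j. j \<in> ?I \<Longrightarrow> d j \<le> Max (d ` ?I)"
        by (auto intro: Max_in)
      \<comment> \<open>The index of largest degree in the relation is taken, so that
        \<open>d i - d j\<close> is not truncated where
        \<open>\<alpha> j \<noteq> 0\<close>.\<close>
      then obtain i where i: "i \<in> I" "\<alpha> i \<noteq> 0" and max: "\<And>j. j \<in> I \<Longrightarrow> \<alpha> j \<noteq> 0 \<Longrightarrow> d j \<le> d i"
        by auto
      text \<open>Adding \<open>h j x\<^sub>i\<close> to each variable \<open>x\<^sub>j\<close>, \<open>j \<noteq> i\<close>, cancels the leading term in \<open>x\<^sub>i\<close>.\<close>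
      define h where "h = (\<lambda>j x. (\<alpha> j / \<alpha> i ^ (p ^ (d i - d j))) * x ^ (p ^ (d i - d j)))"
      define g' where "g' = (\<lambda>x. \<Sum>j\<in>I. g j (h j x))"
      have h_i: "h i x = x" for x using i by (simp add: h_def)
      \<comment> \<open>The factor \<open>(x / \<alpha> i) ^ (p ^ d i)\<close> does not depend on
        \<open>j\<close>, so the relation makes these terms sum to zero. If
        \<open>\<alpha> j = 0\<close>, both sides vanish whatever \<open>d i - d j\<close>
        is.\<close>
      have top: "a j * h j x ^ (p ^ d j) = (a j * \<alpha> j ^ (p ^ d j)) * (x / \<alpha> i) ^ (p ^ d i)"
        if "j \<in> I" for j x
      proof (cases "\<alpha> j = 0")
        case False
        then have "d j \<le> d i" using max that by blast
        then have "(y ^ p ^ (d i - d j)) ^ p ^ d j = y ^ p ^ d i" for y :: 'a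
          by (simp flip: power_mult power_add)
        then show ?thesis
          by (simp add: h_def power_mult_distrib power_divide)
      qed (use p_pos in \<open>simp add: h_def\<close>)
      have "(\<Sum>j\<in>I. a j * h j x ^ (p ^ d j)) = 0" for x
        using \<alpha>(1) by (simp add: top flip: sum_distrib_right)
      then have g': "g' = (\<lambda>x. \<Sum>j\<in>I. l j (h j x))"
        by (auto simp: g'_def g sum.distrib)
      have "(\<lambda>x. l j (h j x)) \<in> ppolys p (d i)" if "j \<in> I" for j
      proof (cases "\<alpha> j = 0")
        case True
        then have "(\<lambda>x. l j (h j x)) = (\<lambda>_. 0)"
          using ppolys_at_0[OF l[OF that]] by (simp add: h_def)
        then show ?thesis using ppolys_zero by simp
      next
        case False
        then have "d j + (d i - d j) = d i" using max that by simp
        with ppolys_comp[OF l[OF that], of "\<alpha> j / \<alpha> i ^ (p ^ (d i - d j))" "d i - d j"]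
        show ?thesis unfolding h_def by simp
      qed
      then have g'_in: "g' \<in> ppolys p (d i)"
        unfolding g' by (rule ppolys_sum)
      have add: "g j (x + y) = g j x + g j y" if "j \<in> I" for j x y
        by (rule ppolys_additive[OF less.prems(2)[OF that]])
      \<comment> \<open>By additivity, replacing \<open>g i\<close> by \<open>g'\<close> amounts to
        adding \<open>h j (x i)\<close> to each \<open>x j\<close> with \<open>j \<noteq> i\<close>.
        This change of variables is undone by subtracting the same terms, so the image stays the
        same.\<close>
      have new: "(\<Sum>j\<in>I. (g(i := g')) j (x j)) =
          (\<Sum>j\<in>I. g j (if j = i then x i else x j + h j (x i)))" for x
      proof -
        have "(\<Sum>j\<in>I. (g(i := g')) j (x j)) = (\<Sum>j\<in>I - {i}. g j (x j)) + g' (x i)"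
          using i less.prems(1) by (simp add: sum.remove add.commute)
        also have "g' (x i) = g i (x i) + (\<Sum>j\<in>I - {i}. g j (h j (x i)))"
          using i less.prems(1) by (simp add: g'_def sum.remove h_i)
        also have "(\<Sum>j\<in>I - {i}. g j (x j)) + \<dots> =
            g i (x i) + (\<Sum>j\<in>I - {i}. g j (x j + h j (x i)))"
          by (simp add: add sum.distrib)
        also have "\<dots> = (\<Sum>j\<in>I. g j (if j = i then x i else x j + h j (x i)))"
          using i less.prems(1) by (simp add: sum.remove)
        finally show ?thesis .
      qed
      have image: "range (\<lambda>x. \<Sum>j\<in>I. (g(i := g')) j (x j)) = range (\<lambda>x. \<Sum>j\<in>I. g j (x j))"
      proof (intro subset_antisym subsetI; clarify)
        fix x
        show "(\<Sum>j\<in>I. (g(i := g')) j (x j)) \<in> range (\<lambda>x. \<Sum>j\<in>I. g j (x j))"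
          unfolding new by (rule rangeI)
        show "(\<Sum>j\<in>I. g j (x j)) \<in> range (\<lambda>x. \<Sum>j\<in>I. (g(i := g')) j (x j))"
          by (rule range_eqI[where x = "\<lambda>j. if j = i then x i else x j - h j (x i)"])
            (simp only: new, auto intro!: sum.cong)
      qed
      have "(\<Sum>j\<in>I. Suc ((m(i := d i)) j)) < (\<Sum>j\<in>I. Suc (m j))"
        using i less.prems(1) m[OF i(1)] by (intro sum_strict_mono_ex1) auto
      from less.hyps[OF this less.prems(1), of "g(i := g')"] less.prems(2) g'_in
      show ?thesis
        unfolding image by simp
    qed
  qed
qed

text \<open>Expanding \<open>x j\<close> in a basis over the \<open>p^(N - d j)\<close>-th powers
  turns \<open>a j * x j ^ (p ^ d j)\<close> into terms of degree \<open>p ^ N\<close> with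
  coefficients \<open>a j * b ^ (p ^ d j)\<close>. A relation between these vanishes in two stages:
  first by independence of the \<open>a j\<close>, then by independence of the basis.\<close>

lemma common_degree_normal_form:
  fixes g :: "'i \<Rightarrow> 'a \<Rightarrow> 'a"
  assumes "finite_degree (range (\<lambda>x::'a. x ^ p))"
    and "finite I" "\<And>i. i \<in> I \<Longrightarrow> g i \<in> ppolys p (m i)"
  shows "\<exists>J N l a. reduced_form p (J :: ('i \<times> 'a) set) (\<lambda>_. N) l a
    (range (\<lambda>x. \<Sum>i\<in>I. g i (x i)))"
proof -
  obtain J d l a where "reduced_form p (J :: 'i set) d l a (range (\<lambda>x. \<Sum>i\<in>I. g i (x i)))"
    using leading_coefficients_independent[of I g m] assms by blast
  then have fin: "finite J" and l: "\<And>j. j \<in> J \<Longrightarrow> l j \<in> ppolys p (d j)"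
    and indep: "\<And>\<alpha> j. (\<Sum>j\<in>J. a j * \<alpha> j ^ (p ^ d j)) = 0 \<Longrightarrow> j \<in> J \<Longrightarrow> \<alpha> j = 0"
    and image: "range (\<lambda>x. \<Sum>i\<in>I. g i (x i)) =
      range (\<lambda>x. \<Sum>j\<in>J. l j (x j) + a j * x j ^ (p ^ d j))"
    unfolding reduced_form_def by blast+
  \<comment> \<open>Any common upper bound of the \<open>d j\<close> would do; the sum is one that
    also makes sense for empty \<open>J\<close>.\<close>
  define N where "N = (\<Sum>j\<in>J. d j)"
  have N: "d j \<le> N" if "j \<in> J" for j
    using that fin unfolding N_def by (intro member_le_sum) auto
  define basis where "basis = (\<lambda>j B. finite B \<and> (\<forall>x::'a. \<exists>y. x = (\<Sum>b\<in>B. b * y b ^ (p ^ (N - d j)))) \<and>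
      (\<forall>y. (\<Sum>b\<in>B. b * y b ^ (p ^ (N - d j))) = 0 \<longrightarrow> (\<forall>b\<in>B. y b = 0)))"
  have "\<exists>B. basis j B" for j
    unfolding basis_def by (rule finite_basis_frob[OF assms(1)])
  then obtain B where "\<And>j. basis j (B j)"
    by metis
  then have B: "\<And>j. finite (B j)"
    and span: "\<And>j x. \<exists>y. x = (\<Sum>b\<in>B j. b * y b ^ (p ^ (N - d j)))"
    and ind: "\<And>j y b. (\<Sum>b\<in>B j. b * y b ^ (p ^ (N - d j))) = 0 \<Longrightarrow> b \<in> B j \<Longrightarrow> y b = 0"
    unfolding basis_def by blast+
  define L where "L = (\<lambda>(j, b) x. l j (b * x ^ (p ^ (N - d j))))"
  define A where "A = (\<lambda>(j, b). a j * b ^ (p ^ d j))"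
  have pow: "a j * (b * x ^ (p ^ (N - d j))) ^ (p ^ d j) = A (j, b) * x ^ (p ^ N)"
    if "j \<in> J" for j b x
    using N[OF that] by (simp add: A_def power_mult_distrib flip: power_mult power_add)
  have Sigma_sum: "(\<Sum>k\<in>Sigma J B. F k) = (\<Sum>j\<in>J. \<Sum>b\<in>B j. F (j, b))" for F :: "'i \<times> 'a \<Rightarrow> 'a"
    using sum.Sigma[of J B "\<lambda>j b. F (j, b)"] fin B by simp
  have A_sum: "(\<Sum>k\<in>Sigma J B. A k * x k ^ (p ^ N)) =
      (\<Sum>j\<in>J. a j * (\<Sum>b\<in>B j. b * x (j, b) ^ (p ^ (N - d j))) ^ (p ^ d j))" for x
    unfolding Sigma_sum by (intro sum.cong refl) (simp add: frob_sum sum_distrib_left pow)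
  have l_sum: "l j (\<Sum>b\<in>C. f b) = (\<Sum>b\<in>C. l j (f b))" if "j \<in> J" for j C and f :: "'a \<Rightarrow> 'a"
    by (induction C rule: infinite_finite_induct)
      (simp_all add: ppolys_at_0[OF l[OF that]] ppolys_additive[OF l[OF that]])
  have L_sum: "(\<Sum>k\<in>Sigma J B. L k (x k)) =
      (\<Sum>j\<in>J. l j (\<Sum>b\<in>B j. b * x (j, b) ^ (p ^ (N - d j))))" for x
    unfolding Sigma_sum by (intro sum.cong refl) (simp add: L_def l_sum)
  have "finite (Sigma J B)" using fin B by simp
  moreover have "L k \<in> ppolys p N" if "k \<in> Sigma J B" for k
  proof -
    from that obtain j b where k: "k = (j, b)" "j \<in> J" by auto
    show ?thesis
      using ppolys_comp[OF l[OF k(2)], of b "N - d j"] N[OF k(2)] by (simp add: k L_def)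
  qed
  moreover have "x k = 0" if *: "(\<Sum>k\<in>Sigma J B. A k * x k ^ (p ^ N)) = 0" "k \<in> Sigma J B" for x k
  proof -
    from that obtain j b where k: "k = (j, b)" "j \<in> J" "b \<in> B j" by auto
    have "(\<Sum>b\<in>B j. b * x (j, b) ^ (p ^ (N - d j))) = 0"
      using indep[OF *(1)[unfolded A_sum] k(2)] .
    from ind[OF this k(3)] show ?thesis by (simp add: k)
  qed
  moreover have "range (\<lambda>x. \<Sum>j\<in>J. l j (x j) + a j * x j ^ (p ^ d j)) =
      range (\<lambda>x. \<Sum>k\<in>Sigma J B. L k (x k) + A k * x k ^ (p ^ N))"
  proof (intro subset_antisym subsetI; clarify)
    fix x :: "'i \<Rightarrow> 'a"
    have "\<forall>j. \<exists>y. x j = (\<Sum>b\<in>B j. b * y b ^ (p ^ (N - d j)))"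
      using span by blast
    from choice[OF this] obtain y
      where "\<And>j. x j = (\<Sum>b\<in>B j. b * y j b ^ (p ^ (N - d j)))"
      by blast
    then show "(\<Sum>j\<in>J. l j (x j) + a j * x j ^ (p ^ d j)) \<in>
        range (\<lambda>x. \<Sum>k\<in>Sigma J B. L k (x k) + A k * x k ^ (p ^ N))"
      by (intro range_eqI[where x = "\<lambda>(j, b). y j b"]) (simp add: sum.distrib A_sum L_sum)
  next
    fix x :: "'i \<times> 'a \<Rightarrow> 'a"
    show "(\<Sum>k\<in>Sigma J B. L k (x k) + A k * x k ^ (p ^ N)) \<in>
        range (\<lambda>x. \<Sum>j\<in>J. l j (x j) + a j * x j ^ (p ^ d j))"
      by (rule range_eqI[where x = "\<lambda>j. \<Sum>b\<in>B j. b * x (j, b) ^ (p ^ (N - d j))"])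
        (simp add: sum.distrib A_sum L_sum)
  qed
  ultimately have "reduced_form p (Sigma J B) (\<lambda>_. N) L A (range (\<lambda>x. \<Sum>i\<in>I. g i (x i)))"
    unfolding reduced_form_def image by blast
  then show ?thesis by blast
qed

end

section \<open>Valuations\<close>

context valued_field
begin

lemma v_0: "v 0 = Pinf"
  by (simp add: eq_Pinf_iff)

lemma v_1: "v 1 = 0"
proof -
  have "v 1 = v 1 + v 1" using mult[of 1 1] by simp
  moreover have "v 1 \<noteq> Pinf" by (simp add: eq_Pinf_iff)
  ultimately show ?thesis
    using not_Minf[of 1] by (cases "v 1") (auto simp: zero_extended_def)
qed

lemma v_minus: "v (- x) = v x"
proof -
  have "v (- 1) + v (- 1) = 0" using mult[of "- 1" "- 1"] by (simp add: v_1)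
  then have "v (- 1) = 0"
    using not_Minf[of "- 1"] by (cases "v (- 1)") (auto simp: zero_extended_def)
  then show ?thesis using mult[of "- 1" x] by simp
qed

lemma v_less_Pinf_iff: "v x < Pinf \<longleftrightarrow> x \<noteq> 0"
  using not_Minf[of x] eq_Pinf_iff[of x] by (cases "v x") auto

lemma v_less_imp_nonzero: "v x < v y \<Longrightarrow> x \<noteq> 0"
  by (auto simp: v_0)

lemma v_mult_left_mono: "v x \<le> v y \<Longrightarrow> v (c * x) \<le> v (c * y)"
  by (simp add: mult add_left_mono)

lemma v_mult_left_strict_mono:
  assumes "c \<noteq> 0" "v x < v y"
  shows "v (c * x) < v (c * y)"
proof (rule ccontr)
  assume "\<not> ?thesis"
  then have "v (inverse c * (c * y)) \<le> v (inverse c * (c * x))"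
    by (rule v_mult_left_mono[OF leI])
  with assms show False by (simp add: mult.assoc[symmetric])
qed

lemma v_power_mono: "v x \<le> v y \<Longrightarrow> v (x ^ k) \<le> v (y ^ k)"
proof (induction k)
  case (Suc k)
  have "v (x * x ^ k) \<le> v (x * y ^ k)" using Suc by (intro v_mult_left_mono)
  also have "\<dots> = v (y ^ k * x)" by (simp add: mult.commute)
  also have "\<dots> \<le> v (y ^ k * y)" using Suc by (intro v_mult_left_mono)
  finally show ?case by (simp add: mult.commute)
qed simp

lemma v_power_le_self:
  assumes "v x \<le> v 1" "k > 0"
  shows "v (x ^ k) \<le> v x"
proof -
  from assms(2) obtain j where "k = Suc j" by (cases k) auto
  moreover have "v (x * x ^ j) \<le> v (x * 1)"
    using v_power_mono[OF assms(1), of j] by (intro v_mult_left_mono) simp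
  ultimately show ?thesis by simp
qed

lemma v_add_greater: "u < v x \<Longrightarrow> u < v y \<Longrightarrow> u < v (x + y)"
  by (rule less_le_trans[OF _ add]) simp

lemma v_sum_greater: "u < Pinf \<Longrightarrow> (\<And>i. i \<in> I \<Longrightarrow> u < v (f i)) \<Longrightarrow> u < v (\<Sum>i\<in>I. f i)"
  by (induction I rule: infinite_finite_induct) (auto simp: v_0 v_add_greater)

text \<open>Bounds are carried as values of field elements, so finitely many of them are combined by
  picking an element of least value.\<close>

lemma ex_v_least:
  assumes "finite A" "A \<noteq> {}"
  obtains a where "a \<in> A" "\<And>b. b \<in> A \<Longrightarrow> v (f a) \<le> v (f b)"
proof -
  have "Min ((\<lambda>a. v (f a)) ` A) \<in> (\<lambda>a. v (f a)) ` A" using assms by (intro Min_in) auto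
  then obtain a where "a \<in> A" "Min ((\<lambda>a. v (f a)) ` A) = v (f a)" by auto
  with assms that[of a] show thesis by (metis Min_le finite_imageI imageI)
qed

text \<open>The power \<open>t ^ (p ^ N)\<close> has at least one factor \<open>t\<close> more than
  the corresponding power in any term of \<open>l\<close>; for \<open>v t\<close> small enough this
  factor outweighs the ratio of the coefficients.\<close>

lemma ppolys_dominated:
  assumes "l \<in> ppolys p n" "n \<le> N" "p \<ge> 2" "w \<noteq> 0"
  shows "\<exists>c. c \<noteq> 0 \<and> (\<forall>t x. v t < v c \<longrightarrow> v t \<le> v x \<longrightarrow> v (w * t ^ (p ^ N)) < v (l x))"
  using assms(1,2)
proof (induction n arbitrary: l)
  case 0
  have "v (w * t ^ (p ^ N)) < v (l x)" if "v t < v 1" for t x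
  proof -
    have "w * t ^ (p ^ N) \<noteq> 0" using v_less_imp_nonzero[OF that] assms(4) by simp
    then have "v (w * t ^ (p ^ N)) < Pinf" by (simp only: v_less_Pinf_iff not_False_eq_True)
    moreover have "l x = 0" using 0 by simp
    ultimately show ?thesis by (simp only: v_0)
  qed
  then show ?case by (intro exI[of _ 1]) simp
next
  case (Suc n)
  then obtain l' a where l: "l = (\<lambda>x. l' x + a * x ^ (p ^ n))" "l' \<in> ppolys p n" by auto
  with Suc obtain c where c: "c \<noteq> 0"
    "\<And>t x. v t < v c \<Longrightarrow> v t \<le> v x \<Longrightarrow> v (w * t ^ (p ^ N)) < v (l' x)"
    by (meson Suc_leD)
  show ?case
  proof (cases "a = 0")
    case True
    with c l show ?thesis by auto
  next
    case False
    \<comment> \<open>Below \<open>1\<close>, surplus factors \<open>t\<close> only lower the value;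
      \<open>c\<close> controls \<open>l'\<close>; below \<open>a / w\<close>, a single factor
      \<open>t\<close> outweighs the coefficients.\<close>
    obtain b where b: "b \<in> {1, c, a / w}" "\<And>d. d \<in> {1, c, a / w} \<Longrightarrow> v b \<le> v d"
      by (rule ex_v_least[of "{1, c, a / w}" "\<lambda>x. x"]) auto
    have "v (w * t ^ (p ^ N)) < v (l x)" if t: "v t < v b" "v t \<le> v x" for t x
    proof -
      have t1: "v t < v 1" "v t < v c" "v t < v (a / w)"
        using b(2) t(1) by (auto intro: less_le_trans)
      have "p ^ n < p ^ N" using Suc.prems(2) assms(3) by (intro power_strict_increasing) auto
      then have "w * t ^ (p ^ N) = (w * t ^ (p ^ n)) * t ^ (p ^ N - p ^ n)"
        by (simp flip: power_add)
      also have "v \<dots> \<le> v ((w * t ^ (p ^ n)) * t)"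
        using t1(1) \<open>p ^ n < p ^ N\<close> by (intro v_mult_left_mono v_power_le_self) auto
      also have "\<dots> < v ((w * t ^ (p ^ n)) * (a / w))"
        using t1(3) v_less_imp_nonzero[OF t(1)] assms(4) by (intro v_mult_left_strict_mono) auto
      also have "(w * t ^ (p ^ n)) * (a / w) = a * t ^ (p ^ n)"
        using assms(4) by simp
      also have "v \<dots> \<le> v (a * x ^ (p ^ n))"
        using t(2) by (intro v_mult_left_mono v_power_mono)
      finally have "v (w * t ^ (p ^ N)) < v (a * x ^ (p ^ n))" .
      with c(2)[OF t1(2) t(2)] show ?thesis by (simp add: l v_add_greater)
    qed
    moreover have "b \<noteq> 0" using b(1) c(1) False assms(4) by auto
    ultimately show ?thesis by blast
  qed
qed

end

section \<open>Extremality\<close>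

text \<open>Polynomial functions without mixed monomials cover all uses of extremality here. The
  index type is arbitrary, so that the pairs indexing a normal form can be used directly.\<close>

inductive_set diagonal_polys :: "'i set \<Rightarrow> (('i \<Rightarrow> 'a::field) \<Rightarrow> 'a) set" for I where
  const: "(\<lambda>_. c) \<in> diagonal_polys I"
| monom: "i \<in> I \<Longrightarrow> (\<lambda>x. c * x i ^ k) \<in> diagonal_polys I"
| add: "F \<in> diagonal_polys I \<Longrightarrow> G \<in> diagonal_polys I \<Longrightarrow> (\<lambda>x. F x + G x) \<in> diagonal_polys I"

lemma diagonal_polys_sum:
  "(\<And>j. j \<in> J \<Longrightarrow> F j \<in> diagonal_polys I) \<Longrightarrow> (\<lambda>x. \<Sum>j\<in>J. F j x) \<in> diagonal_polys I"
  by (induction J rule: infinite_finite_induct)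
    (simp_all add: diagonal_polys.const diagonal_polys.add)

lemma ppolys_diagonal:
  "l \<in> ppolys p n \<Longrightarrow> i \<in> I \<Longrightarrow> (\<lambda>x. l (c * x i)) \<in> diagonal_polys I"
proof (induction n arbitrary: l)
  case 0
  then show ?case by (simp add: diagonal_polys.const)
next
  case (Suc n)
  then obtain l' a where l: "l = (\<lambda>x. l' x + a * x ^ (p ^ n))" "l' \<in> ppolys p n" by auto
  have "(\<lambda>x. l' (c * x i) + (a * c ^ (p ^ n)) * x i ^ (p ^ n)) \<in> diagonal_polys I"
    using Suc.IH[OF l(2) Suc.prems(2)] Suc.prems(2)
    by (intro diagonal_polys.add diagonal_polys.monom)
  then show ?case by (simp add: l(1) power_mult_distrib mult.assoc)
qed

lemma diagonal_polys_cong: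
  "F \<in> diagonal_polys I \<Longrightarrow> (\<And>i. i \<in> I \<Longrightarrow> x i = y i) \<Longrightarrow> F x = F y"
  by (induction rule: diagonal_polys.induct) auto

lemma eval_mpoly_single:
  "eval_mpoly (Poly_Mapping.single m c) a =
    c * (\<Prod>i\<in>Poly_Mapping.keys m. a i ^ Poly_Mapping.lookup m i)"
  by (simp add: eval_mpoly_def)

lemma eval_mpoly_add: "eval_mpoly (f + g) a = eval_mpoly f a + eval_mpoly g a"
  unfolding eval_mpoly_def by (rule Poly_Mapping.setsum_keys_plus_distrib) (simp_all add: algebra_simps)

lemma diagonal_polys_mpoly:
  assumes "F \<in> diagonal_polys I" "h ` I \<subseteq> {..<n}"
  shows "\<exists>g\<in>mpolys n. \<forall>a. eval_mpoly g a = F (\<lambda>i. a (h i))"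
  using assms(1)
proof (induction rule: diagonal_polys.induct)
  case (const c)
  show ?case
    by (rule bexI[of _ "Poly_Mapping.single 0 c"]) (simp_all add: eval_mpoly_single mpolys_def)
next
  case (monom i c k)
  then show ?case
    using assms(2)
    by (intro bexI[of _ "Poly_Mapping.single (Poly_Mapping.single (h i) k) c"])
      (auto simp: eval_mpoly_single mpolys_def)
next
  case (add F G)
  then obtain f g where fg: "f \<in> mpolys n" "g \<in> mpolys n"
    "\<forall>a. eval_mpoly f a = F (\<lambda>i. a (h i))" "\<forall>a. eval_mpoly g a = G (\<lambda>i. a (h i))"
    by blast
  have "f + g \<in> mpolys n"
    using fg(1,2) Poly_Mapping.keys_add[of f g] unfolding mpolys_def by blast
  with fg show ?case by (intro bexI[of _ "f + g"]) (simp_all add: eval_mpoly_add)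
qed

lemma extremal_diagonal:
  fixes F :: "('i \<Rightarrow> 'a::field) \<Rightarrow> 'a"
  assumes "valued_field v" "extremal v" "finite I" "F \<in> diagonal_polys I"
  obtains x where "\<And>i. i \<in> I \<Longrightarrow> x i \<in> valuation_ring v"
    "\<And>y. (\<And>i. i \<in> I \<Longrightarrow> y i \<in> valuation_ring v) \<Longrightarrow> v (F y) \<le> v (F x)"
proof -
  interpret valued_field v by fact
  obtain h where h: "bij_betw h I {0..<card I}"
    using ex_bij_betw_finite_nat[OF assms(3)] by blast
  \<comment> \<open>One variable more than \<open>I\<close> requires, so that
    \<open>n \<ge> 1\<close> holds even for empty \<open>I\<close>.\<close>
  define n where "n = Suc (card I)"
  have hI: "h i < n" if "i \<in> I" for i
    using bij_betwE[OF h] that by (auto simp: n_def less_Suc_eq)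
  then obtain g where g: "g \<in> mpolys n" "\<And>a. eval_mpoly g a = F (\<lambda>i. a (h i))"
    using diagonal_polys_mpoly[OF assms(4), of h n] by blast
  have "has_maximal_element {v (eval_mpoly g a) | a. \<forall>i < n. a i \<in> valuation_ring v}"
    using assms(2) g(1) unfolding extremal_def n_def by auto
  then obtain a where a: "\<forall>i<n. a i \<in> valuation_ring v"
    "\<And>b. \<forall>i<n. b i \<in> valuation_ring v \<Longrightarrow> v (eval_mpoly g b) \<le> v (eval_mpoly g a)"
    unfolding has_maximal_element_def by blast
  show thesis
  proof
    show "a (h i) \<in> valuation_ring v" if "i \<in> I" for i
      using a(1) hI[OF that] by blast
    fix y assume y: "\<And>i. i \<in> I \<Longrightarrow> y i \<in> valuation_ring v"
    \<comment> \<open>Outside the image of \<open>h\<close> the default 0 lies in the valuation ring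
      and does not affect \<open>F\<close>.\<close>
    define b where "b = (\<lambda>j. if j \<in> h ` I then y (inv_into I h j) else 0)"
    have "F y = F (\<lambda>i. b (h i))"
      using bij_betw_imp_inj_on[OF h] by (intro diagonal_polys_cong[OF assms(4)]) (auto simp: b_def)
    moreover have "\<forall>j<n. b j \<in> valuation_ring v"
      using y by (auto simp: b_def inv_into_into valuation_ring_def v_0)
    ultimately show "v (F y) \<le> v (F (\<lambda>i. a (h i)))"
      using a(2)[of b] by (simp add: g(2))
  qed
qed

text \<open>For \<open>t k \<noteq> 0\<close>, dividing by this coordinate of least value gives a
  point over the valuation ring with \<open>k\<close>-th coordinate 1. Extremality bounds the value
  of the form at such points by that of some \<open>F x\<close>, and \<open>w = F x\<close> is
  nonzero by independence. Homogeneity restores the factor \<open>t k ^ (p ^ N)\<close>.\<close>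

lemma leading_form_bound:
  fixes v :: "'a::field \<Rightarrow> 'g::linordered_ab_group_add extended"
  assumes "valued_field v" "extremal v" "p > 0" "reduced_form p J (\<lambda>_. N) l a S" "k \<in> J"
  obtains w where "w \<noteq> 0"
    "\<And>t. (\<And>j. j \<in> J \<Longrightarrow> v (t k) \<le> v (t j)) \<Longrightarrow>
      v (\<Sum>j\<in>J. a j * t j ^ (p ^ N)) \<le> v (w * t k ^ (p ^ N))"
proof -
  interpret valued_field v by fact
  from assms(4) have fin: "finite J"
    and indep: "\<And>\<alpha> j. (\<Sum>j\<in>J. a j * \<alpha> j ^ (p ^ N)) = 0 \<Longrightarrow> j \<in> J \<Longrightarrow> \<alpha> j = 0"
    unfolding reduced_form_def by blast+
  define F where "F = (\<lambda>x. a k + (\<Sum>j\<in>J - {k}. a j * x j ^ (p ^ N)))"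
  have F: "F x = (\<Sum>j\<in>J. a j * (x(k := 1)) j ^ (p ^ N))" for x
    using fin assms(5) by (simp add: F_def sum.remove)
  have "F \<in> diagonal_polys J"
    unfolding F_def by (intro diagonal_polys.add diagonal_polys.const diagonal_polys_sum diagonal_polys.monom) auto
  from extremal_diagonal[OF assms(1,2) fin this] obtain x
    where x: "\<And>y. (\<And>i. i \<in> J \<Longrightarrow> y i \<in> valuation_ring v) \<Longrightarrow> v (F y) \<le> v (F x)"
    by metis
  have "F x \<noteq> 0"
    using indep[of "x(k := 1)", OF _ assms(5)] unfolding F by auto
  moreover have "v (\<Sum>j\<in>J. a j * t j ^ (p ^ N)) \<le> v (F x * t k ^ (p ^ N))"
    if t: "\<And>j. j \<in> J \<Longrightarrow> v (t k) \<le> v (t j)" for t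
  proof (cases "t k = 0")
    case True
    then have "F x * t k ^ (p ^ N) = 0" using assms(3) by simp
    then show ?thesis by (simp only: v_0 le_Pinf)
  next
    case False
    have "t j / t k \<in> valuation_ring v" if "j \<in> J" for j
      using v_mult_left_mono[OF t[OF that], of "inverse (t k)"] False
      by (simp add: valuation_ring_def v_1 field_simps)
    then have "v (F (\<lambda>j. t j / t k)) \<le> v (F x)" by (rule x)
    then have "v (t k ^ (p ^ N) * F (\<lambda>j. t j / t k)) \<le> v (t k ^ (p ^ N) * F x)"
      by (rule v_mult_left_mono)
    also have "t k ^ (p ^ N) * F (\<lambda>j. t j / t k) = (\<Sum>j\<in>J. a j * t j ^ (p ^ N))"
      unfolding F sum_distrib_left using False by (intro sum.cong) (auto simp: power_divide)
    finally show ?thesis by (simp add: mult.commute)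
  qed
  ultimately show thesis by (rule that)
qed

text \<open>For small \<open>v (t k)\<close> the lower terms have value above
  \<open>v (w * t k ^ (p ^ N))\<close>, while the leading form stays at or below it, so no
  cancellation can raise the value of the sum above this bound.\<close>

lemma preimage_bound:
  fixes v :: "'a::field \<Rightarrow> 'g::linordered_ab_group_add extended"
  assumes "valued_field v" "extremal v" "p \<ge> 2" "reduced_form p J (\<lambda>_. N) l a S" "k \<in> J" "z \<noteq> 0"
  shows "\<exists>c. c \<noteq> 0 \<and> (\<forall>t. (\<forall>j\<in>J. v (t k) \<le> v (t j)) \<longrightarrow> v (t k) < v c \<longrightarrow>
    v (\<Sum>j\<in>J. l j (t j) + a j * t j ^ (p ^ N)) < v z)"
proof -
  interpret valued_field v by fact
  have p: "p > 0" using assms(3) by simp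
  from assms(4) have fin: "finite J" and l: "\<And>j. j \<in> J \<Longrightarrow> l j \<in> ppolys p N"
    unfolding reduced_form_def by blast+
  obtain w where w: "w \<noteq> 0"
    "\<And>t. (\<And>j. j \<in> J \<Longrightarrow> v (t k) \<le> v (t j)) \<Longrightarrow>
      v (\<Sum>j\<in>J. a j * t j ^ (p ^ N)) \<le> v (w * t k ^ (p ^ N))"
    using leading_form_bound[OF assms(1,2) p assms(4,5)] by metis
  have "\<forall>j\<in>J. \<exists>c. c \<noteq> 0 \<and> (\<forall>t x. v t < v c \<longrightarrow> v t \<le> v x \<longrightarrow> v (w * t ^ (p ^ N)) < v (l j x))"
    using ppolys_dominated[OF l _ assms(3) w(1)] by blast
  from bchoice[OF this] obtain d where d: "\<And>j. j \<in> J \<Longrightarrow> d j \<noteq> 0"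
    "\<And>j t x. j \<in> J \<Longrightarrow> v t < v (d j) \<Longrightarrow> v t \<le> v x \<Longrightarrow> v (w * t ^ (p ^ N)) < v (l j x)"
    by blast
  \<comment> \<open>Below \<open>1\<close>, the power \<open>t k ^ (p ^ N)\<close> has at most the
    value of \<open>t k\<close>; below \<open>z / w\<close>, the bound falls under
    \<open>v z\<close>; the \<open>d j\<close> control the lower terms.\<close>
  obtain c where c: "c \<in> {1, z / w} \<union> d ` J" "\<And>b. b \<in> {1, z / w} \<union> d ` J \<Longrightarrow> v c \<le> v b"
    using fin by (rule_tac ex_v_least[of "{1, z / w} \<union> d ` J" "\<lambda>x. x"]) auto
  have "v (\<Sum>j\<in>J. l j (t j) + a j * t j ^ (p ^ N)) < v z"
    if t: "\<And>j. j \<in> J \<Longrightarrow> v (t k) \<le> v (t j)" "v (t k) < v c" for t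
  proof -
    let ?u = "v (w * t k ^ (p ^ N))"
    have t1: "v (t k) < v 1" "v (t k) < v (z / w)" "\<And>j. j \<in> J \<Longrightarrow> v (t k) < v (d j)"
      using c(2) t(2) by (auto intro: less_le_trans)
    have "w * t k ^ (p ^ N) \<noteq> 0"
      using w(1) v_less_imp_nonzero[OF t(2)] by simp
    then have "?u < Pinf" by (simp only: v_less_Pinf_iff not_False_eq_True)
    then have lower: "?u < v (\<Sum>j\<in>J. l j (t j))"
      by (rule v_sum_greater) (rule d(2)[OF _ t1(3) t(1)])
    have upper: "v (\<Sum>j\<in>J. a j * t j ^ (p ^ N)) \<le> ?u"
      using w(2) t(1) by blast
    have "v (\<Sum>j\<in>J. l j (t j) + a j * t j ^ (p ^ N)) \<le> ?u"
    proof (rule ccontr)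
      assume "\<not> ?thesis"
      then have "?u < v (\<Sum>j\<in>J. l j (t j) + a j * t j ^ (p ^ N))" by simp
      moreover have "?u < v (- (\<Sum>j\<in>J. l j (t j)))" using lower by (simp only: v_minus)
      ultimately have "?u < v ((\<Sum>j\<in>J. l j (t j) + a j * t j ^ (p ^ N)) + - (\<Sum>j\<in>J. l j (t j)))"
        by (rule v_add_greater)
      with upper show False by (simp add: sum.distrib)
    qed
    also have "?u \<le> v (w * t k)"
      using t1(1) p by (intro v_mult_left_mono v_power_le_self) auto
    also have "\<dots> < v (w * (z / w))"
      using t1(2) w(1) by (intro v_mult_left_strict_mono)
    finally show ?thesis using w(1) by simp
  qed
  moreover have "c \<noteq> 0" using c(1) d(1) w(1) assms(6) by auto
  ultimately show ?thesis by blast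
qed

text \<open>If some coordinate of \<open>t\<close> has value below \<open>v c\<close>, then
  \<open>v (H t) < v z\<close>, so \<open>H t\<close> is no closer to \<open>z\<close> than 0 is.
  All other preimages lie in \<open>c\<close> times the valuation ring, where extremality supplies a
  best one, at least as good as the preimage 0.\<close>

lemma reduced_form_optimal_approximation:
  fixes v :: "'a::field \<Rightarrow> 'g::linordered_ab_group_add extended"
  assumes "valued_field v" "extremal v" "CHAR('a) = p" "p > 0" "reduced_form p J (\<lambda>_. N) l a S"
  shows "optimal_approximation v S"
  unfolding optimal_approximation_def
proof
  fix z
  interpret valued_field v by fact
  from assms(5) have fin: "finite J" and l: "\<And>j. j \<in> J \<Longrightarrow> l j \<in> ppolys p N"
    unfolding reduced_form_def by blast+
  have p2: "p \<ge> 2" using prime_p[OF assms(3,4)] by (rule prime_ge_2_nat)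
  define G where "G = (\<lambda>j x. l j x + a j * x ^ (p ^ N))"
  define H where "H = (\<lambda>x. \<Sum>j\<in>J. G j (x j))"
  have S: "S = range H"
    using assms(5) by (simp add: reduced_form_def H_def G_def)
  have G: "G j \<in> ppolys p (Suc N)" if "j \<in> J" for j
    using l[OF that] by (auto simp: G_def)
  have H0: "H (\<lambda>_. 0) = 0"
    using ppolys_at_0[OF assms(3,4) G] by (simp add: H_def)
  have H_minus: "H (\<lambda>j. - x j) = - H x" for x
  proof -
    have "H (\<lambda>j. - x j) + H x = H (\<lambda>_. 0)"
      unfolding H_def sum.distrib[symmetric]
      by (intro sum.cong) (simp_all add: ppolys_additive[OF assms(3,4) G, symmetric])
    then show ?thesis using H0 by (simp add: eq_neg_iff_add_eq_0)
  qed
  show "\<exists>y\<in>S. \<forall>x\<in>S. v (z - x) \<le> v (z - y)"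
  proof (cases "z = 0")
    case True
    then show ?thesis using H0 S by (intro bexI[of _ 0]) (auto simp: v_0 intro: range_eqI)
  next
    case False
    have "\<forall>k\<in>J. \<exists>c. c \<noteq> 0 \<and> (\<forall>t. (\<forall>j\<in>J. v (t k) \<le> v (t j)) \<longrightarrow> v (t k) < v c \<longrightarrow> v (H t) < v z)"
      using preimage_bound[OF assms(1,2) p2 assms(5) _ False] unfolding H_def G_def by blast
    from bchoice[OF this] obtain d where d: "\<And>k. k \<in> J \<Longrightarrow> d k \<noteq> 0"
      "\<And>k t. k \<in> J \<Longrightarrow> \<forall>j\<in>J. v (t k) \<le> v (t j) \<Longrightarrow> v (t k) < v (d k) \<Longrightarrow> v (H t) < v z"
      by blast
    \<comment> \<open>The coordinate of least value varies with the preimage, so \<open>c\<close>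
      has to serve every \<open>d k\<close>; the \<open>1\<close> covers empty
      \<open>J\<close>.\<close>
    obtain c where c: "c \<in> insert 1 (d ` J)" "\<And>b. b \<in> insert 1 (d ` J) \<Longrightarrow> v c \<le> v b"
      using fin by (rule_tac ex_v_least[of "insert 1 (d ` J)" "\<lambda>x. x"]) auto
    have c0: "c \<noteq> 0" using c(1) d(1) by auto
    \<comment> \<open>By additivity the sign is moved into the argument, so that z - H(c x) becomes
      a sum of the shape generated by \<open>diagonal_polys\<close>.\<close>
    define F where "F = (\<lambda>x. z + (\<Sum>j\<in>J. G j ((- c) * x j)))"
    have F: "F x = z - H (\<lambda>j. c * x j)" for x
      using H_minus[of "\<lambda>j. c * x j"] by (simp add: F_def H_def)
    have "F \<in> diagonal_polys J"
      unfolding F_def using G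
      by (intro diagonal_polys.add diagonal_polys.const diagonal_polys_sum ppolys_diagonal)
    from extremal_diagonal[OF assms(1,2) fin this] obtain y
      where y: "\<And>x. (\<And>i. i \<in> J \<Longrightarrow> x i \<in> valuation_ring v) \<Longrightarrow> v (F x) \<le> v (F y)"
      by metis
    have "v (z - H t) \<le> v (F y)" for t
    proof (cases "\<exists>j\<in>J. v (t j) < v c")
      case True
      then have "J \<noteq> {}" by blast
      then obtain k where k: "k \<in> J" "\<And>j. j \<in> J \<Longrightarrow> v (t k) \<le> v (t j)"
        using ex_v_least[OF fin] by metis
      have "v (t k) < v c" using True k(2) by (auto intro: le_less_trans)
      also have "v c \<le> v (d k)" using c(2) k(1) by blast
      finally have less: "v (H t) < v z" using d(2) k by blast
      \<comment> \<open>Otherwise \<open>H t\<close>, as the difference of \<open>z\<close> and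
        \<open>z - H t\<close>, would have a value above its own.\<close>
      have "v (z - H t) \<le> v (H t)"
      proof (rule ccontr)
        assume "\<not> ?thesis"
        then have "v (H t) < v (- (z - H t))" unfolding v_minus by simp
        from v_add_greater[OF less this] show False by simp
      qed
      also have "\<dots> \<le> v z" using less by simp
      also have "v z = v (F (\<lambda>_. 0))" by (simp add: F H0)
      also have "\<dots> \<le> v (F y)" by (rule y) (simp add: valuation_ring_def v_0)
      finally show ?thesis .
    next
      case False
      have "v (F (\<lambda>j. t j / c)) \<le> v (F y)"
      proof (rule y)
        fix j assume "j \<in> J"
        with False have "v c \<le> v (t j)" by (simp add: not_less)
        from v_mult_left_mono[OF this, of "inverse c"] c0
        show "t j / c \<in> valuation_ring v" by (simp add: valuation_ring_def v_1 field_simps)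
      qed
      then show ?thesis using c0 by (simp add: F)
    qed
    then show ?thesis
      unfolding S F by blast
  qed
qed

section \<open>Decomposition of an additive polynomial along the coordinate axes\<close>

lemma additive_mpoly_eq_sum:
  assumes "f \<in> mpolys n" "additive_mpoly f"
  shows "eval_mpoly f x = (\<Sum>i<n. eval_mpoly f (\<lambda>j. if j = i then x i else 0))"
proof -
  have add: "eval_mpoly f (\<lambda>i. x i + y i) = eval_mpoly f x + eval_mpoly f y" for x y
    using assms(2) by (simp add: additive_mpoly_def)
  \<comment> \<open>The point is built up one coordinate at a time, and additivity splits off each
    new coordinate.\<close>
  have "(\<Sum>i<m. eval_mpoly f (\<lambda>j. if j = i then x i else 0)) =
      eval_mpoly f (\<lambda>j. if j < m then x j else 0)" for m
  proof (induction m)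
    case 0
    have "eval_mpoly f (\<lambda>_. 0) + eval_mpoly f (\<lambda>_. 0) = eval_mpoly f (\<lambda>_. 0) + 0"
      using add[of "\<lambda>_. 0" "\<lambda>_. 0"] by simp
    then have "eval_mpoly f (\<lambda>_. 0) = 0" by (rule add_left_imp_eq)
    then show ?case by simp
  next
    case (Suc m)
    have "(\<lambda>j. if j < Suc m then x j else 0) =
        (\<lambda>j. (if j < m then x j else 0) + (if j = m then x m else 0))"
      by (auto simp: less_Suc_eq)
    with Suc show ?case by (simp add: add)
  qed
  also have "eval_mpoly f (\<lambda>j. if j < n then x j else 0) = eval_mpoly f x"
    by (rule eval_mpoly_cong[OF assms(1)]) simp
  finally show ?thesis by simp
qed

lemma eval_mpoly_axis_poly: "\<exists>q. \<forall>t. eval_mpoly f (\<lambda>j. if j = i then t else 0) = poly q t"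
proof
  let ?q = "\<Sum>m\<in>Poly_Mapping.keys f. [:Poly_Mapping.lookup f m:] *
    (\<Prod>j\<in>Poly_Mapping.keys m. (if j = i then [:0, 1:] else 0) ^ Poly_Mapping.lookup m j)"
  show "\<forall>t. eval_mpoly f (\<lambda>j. if j = i then t else 0) = poly ?q t"
    by (auto simp: eval_mpoly_def poly_sum poly_prod poly_power intro!: sum.cong prod.cong)
qed

theorem theorem1p8:
  fixes v :: "'a::field \<Rightarrow> 'g::linordered_ab_group_add extended"
    and p n :: nat
    and f :: "'a mpoly"
  assumes "valued_field v"
    and "extremal v"
    and "CHAR('a) = p" and "p > 0"
    and "finite_degree (range (\<lambda>x::'a. x ^ p))"
    and "n \<ge> 1"
    and "f \<in> mpolys n"
    and "additive_mpoly f"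
  shows "optimal_approximation v (range (eval_mpoly f))"
proof (cases "finite (UNIV :: 'a set)")
  case True
  show ?thesis
    unfolding optimal_approximation_def
  proof
    fix z
    let ?V = "(\<lambda>x. v (z - x)) ` range (eval_mpoly f)"
    have fin: "finite (range (eval_mpoly f))"
      using True by (rule finite_subset[OF subset_UNIV])
    then have "Max ?V \<in> ?V" by (intro Max_in) auto
    then obtain y where "y \<in> range (eval_mpoly f)" "Max ?V = v (z - y)" by blast
    moreover have "v (z - x) \<le> Max ?V" if "x \<in> range (eval_mpoly f)" for x
      using fin that by (intro Max_ge) auto
    ultimately show "\<exists>y\<in>range (eval_mpoly f). \<forall>x\<in>range (eval_mpoly f). v (z - x) \<le> v (z - y)"
      by metis
  qed
next
  case False
  define g where "g = (\<lambda>i t. eval_mpoly f (\<lambda>j. if j = i then t else 0))"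
  \<comment> \<open>Each restriction to an axis is an additive one-variable polynomial, and the
    infinite field itself serves as the set \<open>A\<close> in
    \<open>additive_poly_in_ppolys\<close>.\<close>
  have "\<exists>m. g i \<in> ppolys p m" for i
  proof -
    obtain q where q: "g i = poly q"
      using eval_mpoly_axis_poly[of f i] unfolding g_def by blast
    have "poly q (x + y) = poly q x + poly q y" for x y
    proof -
      have "(\<lambda>j. if j = i then x + y else 0) =
          (\<lambda>j. (if j = i then x else 0) + (if j = i then y else 0))" by auto
      then have "g i (x + y) = g i x + g i y"
        using assms(8) by (simp add: g_def additive_mpoly_def)
      then show ?thesis by (simp add: q)
    qed
    then show ?thesis
      unfolding q by (intro additive_poly_in_ppolys[OF assms(3,4) False]) auto
  qed
  then obtain m where m: "\<And>i. g i \<in> ppolys p (m i)" by metis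
  have "eval_mpoly f = (\<lambda>x. \<Sum>i<n. g i (x i))"
    unfolding g_def by (rule ext) (rule additive_mpoly_eq_sum[OF assms(7,8)])
  moreover obtain J N l a where
    "reduced_form p (J :: (nat \<times> 'a) set) (\<lambda>_. N) l a (range (\<lambda>x. \<Sum>i<n. g i (x i)))"
    using common_degree_normal_form[OF assms(3,4,5), of "{..<n}" g m] m by blast
  ultimately show ?thesis
    using reduced_form_optimal_approximation[OF assms(1-4)] by metis
qed

end
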